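(* Let $X\subset\mathbb{R}^d$ be compact, let $v:\tau S^1\times X\to\mathbb{R}^d$ be a continuous, time-periodic (period $\tau$) vector field, and let $\{A_r\}$ be a nice time-periodic (period $\tau$) family of subsets of $X$. Then for every $s_1,s_2\in\tau S^1$ one has $$E(\{A_r\}_{r\ge s_1})=E(\{A_r\}_{r\ge s_2}).$$
   Context: $S^1$ is the circle of unit circumference; $\tau S^1$ is identified with $[0,\tau)$, and for any $t\in\mathbb{R}$ one sets $A_t:=A_{t\bmod\tau}$. $m$ denotes Lebesgue measure. $\phi_{t_1,t_2}$ is the flow map of the ODE $\dot x(t)=v(t,x(t))$ on $X$ from time $t_1$ to time $t_2\ge t_1$, with the convention $\phi_{t_1,t_2}=(\phi_{t_2,t_1})^{-1}$ if $t_2<t_1$. A family of measurable sets $\{A_\theta\}_{\theta\in\tau S^1}$ is called nice if (a) $A_\theta$ is closed and has nonempty interior for every $\theta\in\tau S^1$; and (b) $h(A_\theta,A_{\theta+\sigma})\to0$ as $\sigma\to0$ for all $\theta\in\tau S^1$, where $h$ is the Hausdorff distance of two sets. The survivor set is $A_{s,t}=\bigcap_{r\in[s,t]}\phi_{r,s}A_r=\{x\in X:\phi_{s,r}x\in A_r\ \forall r\in[s,t]\}$ (which is measurable for nice families), and the (lower) escape rate of the family starting at time $s$ is $$E(\{A_r\}_{r\ge s})=-\limsup_{t\to\infty}\frac1{t-s}\log m(A_{s,t}).$$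
   Formalization: The vector field v is additionally assumed Lipschitz in x on X, uniformly in t; for a merely continuous v, even with unique solutions staying in X, the flow can send sets of positive measure to null sets and the equality of escape rates fails. *)

theory Defs
  imports "HOL-Analysis.Analysis"
begin

text \<open>
  Objects on the circle of circumference \<open>\<tau>\<close> are represented by \<open>\<tau>\<close>-periodic functions of a
  real variable.
\<close>

text \<open>
  \<open>\<phi> s t\<close> transports the state at time \<open>s\<close> to the state at time \<open>t\<close>. Solutions starting in \<open>X\<close> are
  required to stay in \<open>X\<close> for all later times; the derivative at the initial time is the
  right-hand one, since the solution need not extend backwards inside \<open>X\<close>. The last clause is the
  convention that \<open>\<phi> t s\<close> is the inverse of \<open>\<phi> s t\<close> for \<open>s \<le> t\<close>. It constrains \<open>\<phi> t s\<close>
  only on the image of \<open>\<phi> s t\<close>, so that backward invariance of \<open>X\<close> is not assumed.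
  Uniqueness of solutions is not part of the definition.
\<close>

definition is_flow_map ::
    "(real \<Rightarrow> 'a::euclidean_space \<Rightarrow> 'a) \<Rightarrow> 'a set \<Rightarrow> (real \<Rightarrow> real \<Rightarrow> 'a \<Rightarrow> 'a) \<Rightarrow> bool"
  where "is_flow_map v X \<phi> \<longleftrightarrow>
    (\<forall>s. \<forall>x\<in>X. \<phi> s s x = x \<and>
       (\<forall>t\<ge>s. \<phi> s t x \<in> X \<and>
          ((\<lambda>r. \<phi> s r x) has_vector_derivative v t (\<phi> s t x)) (at t within {s..}) \<and>
          \<phi> t s (\<phi> s t x) = x))"

text \<open>
  The suprema are meaningful when both sets are nonempty and bounded.
\<close>

definition hausdorff_distance :: "'a::metric_space set \<Rightarrow> 'a set \<Rightarrow> real"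
  where "hausdorff_distance S T = max (SUP x\<in>S. infdist x T) (SUP y\<in>T. infdist y S)"

definition nice_family :: "(real \<Rightarrow> 'a::euclidean_space set) \<Rightarrow> bool"
  where "nice_family A \<longleftrightarrow>
    (\<forall>\<theta>. closed (A \<theta>) \<and> interior (A \<theta>) \<noteq> {}) \<and>
    (\<forall>\<theta>. ((\<lambda>\<sigma>. hausdorff_distance (A \<theta>) (A (\<theta> + \<sigma>))) \<longlongrightarrow> 0) (at 0))"

definition survivor_set ::
    "'a set \<Rightarrow> (real \<Rightarrow> real \<Rightarrow> 'a \<Rightarrow> 'a) \<Rightarrow> (real \<Rightarrow> 'a set) \<Rightarrow> real \<Rightarrow> real \<Rightarrow> 'a set"
  where "survivor_set X \<phi> A s t = {x \<in> X. \<forall>r\<in>{s..t}. \<phi> s r x \<in> A r}"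

lemma survivor_set_eq_Inter_image:
  assumes flow: "is_flow_map v X \<phi>" and "s \<le> t"
    and A: "\<And>r. A r \<subseteq> X"
    and surj: "\<And>r. r \<in> {s..t} \<Longrightarrow> \<phi> s r ` X = X"
  shows "survivor_set X \<phi> A s t = (\<Inter>r\<in>{s..t}. \<phi> r s ` A r)"
proof -
  have inv: "\<phi> r s (\<phi> s r x) = x" if "x \<in> X" "s \<le> r" for x r
    using flow that unfolding is_flow_map_def by blast
  have "\<phi> r s ` A r = {x \<in> X. \<phi> s r x \<in> A r}" if r: "r \<in> {s..t}" for r
  proof (intro subset_antisym subsetI)
    fix x assume "x \<in> \<phi> r s ` A r"
    then obtain y where y: "y \<in> A r" "x = \<phi> r s y" by blast
    then obtain z where "z \<in> X" "y = \<phi> s r z" using A surj[OF r] by blast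
    then show "x \<in> {x \<in> X. \<phi> s r x \<in> A r}" using y inv r by auto
  next
    fix x assume "x \<in> {x \<in> X. \<phi> s r x \<in> A r}"
    then show "x \<in> \<phi> r s ` A r" using inv[of x r] r by (force intro: rev_image_eqI)
  qed
  then show ?thesis using \<open>s \<le> t\<close> unfolding survivor_set_def by force
qed

definition log_ereal :: "real \<Rightarrow> ereal"
  where "log_ereal u = (if u = 0 then -\<infinity> else ereal (ln u))"

definition escape_rate ::
    "'a::euclidean_space set \<Rightarrow> (real \<Rightarrow> real \<Rightarrow> 'a \<Rightarrow> 'a) \<Rightarrow> (real \<Rightarrow> 'a set) \<Rightarrow> real \<Rightarrow> ereal"
  where "escape_rate X \<phi> A s =
    - Limsup at_top (\<lambda>t. ereal (1 / (t - s)) * log_ereal (measure lebesgue (survivor_set X \<phi> A s t)))"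

end

theory Submission
  imports Defs
begin

text \<open>
  For \<open>s \<le> s'\<close> the flow maps the survivor set from \<open>s\<close> into the one from \<open>s'\<close>, and by Gronwall's
  inequality its inverse on the image is Lipschitz with a constant independent of \<open>t\<close>. So
  \<open>m(A\<^sub>s\<^sub>,\<^sub>t) \<le> C m(A\<^sub>s\<^sub>'\<^sub>,\<^sub>t)\<close>, and the escape rate is a nonincreasing function of the starting
  time. Uniqueness of solutions makes it also periodic, hence constant.
\<close>

section \<open>Lebesgue measure of Lipschitz images\<close>

text \<open>By the l1 bound, two points of a cube of side \<open>d\<close> are at distance at most
  \<open>DIM('a) * d\<close>. Every image point is therefore within
  \<open>?e = B * DIM('a) * d\<close> of \<open>f z\<close> in each coordinate, so a cube of side
  \<open>2 * ?e\<close> centred at \<open>f z\<close> works. The constant is crude, but only its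
  finiteness matters later.\<close>

lemma cube_lipschitz_image:
  fixes f :: "'a::euclidean_space \<Rightarrow> 'a"
  assumes lip: "B-lipschitz_on S f" and z: "z \<in> S" "z \<in> cbox u v"
    and side: "\<And>i. i \<in> Basis \<Longrightarrow> v \<bullet> i - u \<bullet> i = d"
  obtains a b where "f ` (S \<inter> cbox u v) \<subseteq> cbox a b"
    "measure lebesgue (cbox a b) = (2 * B * DIM('a)) ^ DIM('a) * measure lebesgue (cbox u v)"
proof -
  have B: "0 \<le> B" using lip by (rule lipschitz_on_nonneg)
  have uv: "u \<bullet> i \<le> v \<bullet> i" if "i \<in> Basis" for i
    using z(2) that by (fastforce simp: mem_box)
  then have d: "0 \<le> d" using side SOME_Basis by (metis diff_ge_0_iff_ge)
  let ?e = "B * DIM('a) * d"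
  have e: "0 \<le> ?e" using B d by simp
  have near: "\<bar>(f y - f z) \<bullet> i\<bar> \<le> ?e" if y: "y \<in> S" "y \<in> cbox u v" and i: "i \<in> Basis" for y i
  proof -
    have "\<bar>(y - z) \<bullet> j\<bar> \<le> d" if "j \<in> Basis" for j
    proof -
      have "u \<bullet> j \<le> y \<bullet> j" "y \<bullet> j \<le> v \<bullet> j" "u \<bullet> j \<le> z \<bullet> j" "z \<bullet> j \<le> v \<bullet> j"
        using y(2) z(2) that by (auto simp: mem_box)
      with side[OF that] show ?thesis by (simp add: inner_diff_left)
    qed
    then have "(\<Sum>j\<in>Basis. \<bar>(y - z) \<bullet> j\<bar>) \<le> DIM('a) * d"
      by (intro sum_bounded_above) auto
    then have yz: "dist y z \<le> DIM('a) * d"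
      using norm_le_l1[of "y - z"] by (simp add: dist_norm)
    have "\<bar>(f y - f z) \<bullet> i\<bar> \<le> dist (f y) (f z)"
      using i by (simp add: dist_norm Basis_le_norm)
    also have "\<dots> \<le> B * dist y z" using lipschitz_onD[OF lip y(1) z(1)] .
    also have "\<dots> \<le> ?e" using mult_left_mono[OF yz B] by (simp add: mult.assoc)
    finally show ?thesis .
  qed
  show thesis
  proof
    show "f ` (S \<inter> cbox u v) \<subseteq> cbox (f z - ?e *\<^sub>R One) (f z + ?e *\<^sub>R One)"
    proof (clarsimp simp: mem_box)
      fix y i assume "y \<in> S" "\<forall>i\<in>Basis. u \<bullet> i \<le> y \<bullet> i \<and> y \<bullet> i \<le> v \<bullet> i" and i: "(i::'a) \<in> Basis"
      then have "\<bar>(f y - f z) \<bullet> i\<bar> \<le> ?e" using near by (simp add: mem_box)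
      then show "(f z - ?e *\<^sub>R One) \<bullet> i \<le> f y \<bullet> i \<and> f y \<bullet> i \<le> (f z + ?e *\<^sub>R One) \<bullet> i"
        using i by (simp add: inner_diff_left inner_add_left abs_le_iff)
    qed
    have "measure lborel (cbox u v) = (\<Prod>i\<in>(Basis::'a set). d)"
      using uv side by (subst content_cbox) (auto intro!: prod.cong)
    moreover have "measure lborel (cbox (f z - ?e *\<^sub>R One) (f z + ?e *\<^sub>R One)) = (\<Prod>i\<in>(Basis::'a set). 2 * ?e)"
      using e by (subst content_cbox)
        (auto intro!: prod.cong simp: inner_diff_left inner_add_left mult_ac)
    ultimately show "measure lebesgue (cbox (f z - ?e *\<^sub>R One) (f z + ?e *\<^sub>R One)) =
        (2 * B * DIM('a)) ^ DIM('a) * measure lebesgue (cbox u v)"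
      by (simp add: power_mult_distrib mult_ac)
  qed
qed

text \<open>Cover \<open>S\<close> by countably many nonoverlapping cubes inside an open set of
  almost the same measure, and replace each cube by one containing the image of its part of
  \<open>S\<close>. Compactness bounds \<open>S\<close> and makes the image measurable.\<close>

lemma measure_lipschitz_image_le:
  fixes f :: "'a::euclidean_space \<Rightarrow> 'a"
  assumes lip: "B-lipschitz_on S f" and S: "compact S"
  shows "measure lebesgue (f ` S) \<le> (2 * B * DIM('a)) ^ DIM('a) * measure lebesgue S"
proof (rule field_le_epsilon)
  fix e :: real assume e: "0 < e"
  let ?c = "(2 * B * DIM('a)) ^ DIM('a)"
  have c: "0 \<le> ?c" using lipschitz_on_nonneg[OF lip] by simp
  have Sm: "S \<in> lmeasurable" using S by (rule lmeasurable_compact)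
  \<comment> \<open>The summand 1 keeps the denominator positive when \<open>?c = 0\<close>, and
    \<open>?c * (e / (?c + 1)) \<le> e\<close> still holds.\<close>
  have "0 < e / (?c + 1)" using e c by (intro divide_pos_pos) linarith+
  then obtain T where T: "open T" "S \<subseteq> T" "T - S \<in> lmeasurable"
      and eT: "emeasure lebesgue (T - S) < ennreal (e / (?c + 1))"
    using sets_lebesgue_outer_open[of S "e / (?c + 1)"] Sm by blast
  have Tm: "T \<in> lmeasurable" using fmeasurable_Diff_D[OF T(3) Sm T(2)] .
  have mTS: "measure lebesgue (T - S) \<le> e / (?c + 1)"
    using eT T(3) e c by (simp add: emeasure_eq_measure2 ennreal_less_iff)
  have "measure lebesgue T = measure lebesgue S + measure lebesgue (T - S)"
    using measurable_measure_Diff[OF Tm _ T(2)] Sm by auto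
  then have "?c * measure lebesgue T \<le> ?c * measure lebesgue S + ?c * (e / (?c + 1))"
    using mTS c by (simp add: distrib_left mult_left_mono flip: times_divide_eq_right)
  also have "?c * (e / (?c + 1)) \<le> e"
    using e c by (simp add: field_simps)
  finally have cT: "?c * measure lebesgue T \<le> ?c * measure lebesgue S + e" by simp
  obtain r where "0 < r" and r: "S \<subseteq> cbox (- r *\<^sub>R One) (r *\<^sub>R One)"
  proof -
    obtain b where b: "0 < b" "\<And>x. x \<in> S \<Longrightarrow> norm x \<le> b"
      using compact_imp_bounded[OF S] bounded_pos by metis
    show thesis
    proof
      show "S \<subseteq> cbox (- b *\<^sub>R One) (b *\<^sub>R One)"
      proof
        fix x assume "x \<in> S"
        then have "\<bar>x \<bullet> i\<bar> \<le> b" if "i \<in> Basis" for i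
          using Basis_le_norm[OF that, of x] b(2)[of x] by linarith
        then show "x \<in> cbox (- b *\<^sub>R One) (b *\<^sub>R One)"
          by (fastforce simp: mem_box abs_le_iff)
      qed
    qed (fact b)
  qed
  then have ne: "box (- r *\<^sub>R One) (r *\<^sub>R One :: 'a) \<noteq> {}"
    by (simp add: box_ne_empty)
  \<comment> \<open>The tag of each covering cube lies in \<open>S\<close>, hence in
    \<open>T\<close>, so this gauge forces the cube into \<open>T\<close>. The value
    \<open>UNIV\<close> only makes it a gauge at the remaining points.\<close>
  have "gauge (\<lambda>x. if x \<in> T then T else UNIV)"
    using T(1) by (auto simp: gauge_def)
  then obtain \<D> where D: "countable \<D>" and "\<Union>\<D> \<subseteq> cbox (- r *\<^sub>R One) (r *\<^sub>R One)"
      and cbox: "\<And>K. K \<in> \<D> \<Longrightarrow> interior K \<noteq> {} \<and> (\<exists>c d. K = cbox c d)"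
      and pw: "pairwise (\<lambda>A B. interior A \<inter> interior B = {}) \<D>"
      and KT: "\<And>K. K \<in> \<D> \<Longrightarrow> \<exists>x \<in> S \<inter> K. K \<subseteq> (if x \<in> T then T else UNIV)"
      and side: "\<And>u v. cbox u v \<in> \<D> \<Longrightarrow>
        \<exists>n. \<forall>i \<in> Basis. v \<bullet> i - u \<bullet> i = ((r *\<^sub>R One) \<bullet> i - (- r *\<^sub>R One) \<bullet> i) / 2^n"
      and SD: "S \<subseteq> \<Union>\<D>"
    by (rule covering_lemma[OF r ne]) (rule that)
  \<comment> \<open>The enclosing box is a cube, so its dyadic pieces have equal sides. The tag of
    \<open>K\<close>, a point of \<open>S\<close>, serves as the \<open>z\<close> around which the
    image cube is centred.\<close>
  have "\<exists>a b. f ` (S \<inter> K) \<subseteq> cbox a b \<and> measure lebesgue (cbox a b) = ?c * measure lebesgue K" if KD: "K \<in> \<D>" for K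
  proof -
    obtain u v where K: "K = cbox u v" using cbox[OF KD] by blast
    obtain z where z: "z \<in> S" "z \<in> cbox u v" using KT[OF KD] K by blast
    obtain n where "\<And>i. i \<in> Basis \<Longrightarrow> v \<bullet> i - u \<bullet> i = (2 * r) / 2^n"
      using side KD K by fastforce
    then show ?thesis using cube_lipschitz_image[OF lip z] K by metis
  qed
  then obtain a b where ab: "\<And>K. K \<in> \<D> \<Longrightarrow> f ` (S \<inter> K) \<subseteq> cbox (a K) (b K)"
      and cont: "\<And>K. K \<in> \<D> \<Longrightarrow> measure lebesgue (cbox (a K) (b K)) = ?c * measure lebesgue K"
    by metis
  \<comment> \<open>A bound uniform over finite subfamilies gives both the measurability of the
    countable union and the same bound for it. In a finite subfamily the disjoint interiors let the
    measures of the cubes add up.\<close>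
  have bound: "measure lebesgue (\<Union>K\<in>\<F>. cbox (a K) (b K)) \<le> ?c * measure lebesgue S + e"
    if F: "\<F> \<subseteq> \<D>" "finite \<F>" for \<F>
  proof -
    have "{} \<notin> \<F>" using cbox F by force
    then have div: "\<F> division_of \<Union>\<F>"
      using pairwise_subset[OF pw F(1)] cbox F unfolding pairwise_def
      by (intro division_ofI) (auto 4 3)
    have "measure lebesgue (\<Union>K\<in>\<F>. cbox (a K) (b K)) \<le> (\<Sum>K\<in>\<F>. measure lebesgue (cbox (a K) (b K)))"
      using F(2) by (intro measure_UNION_le) auto
    also have "\<dots> = (\<Sum>K\<in>\<F>. ?c * measure lebesgue K)"
      using F(1) cont by (intro sum.cong) auto
    also have "\<dots> = ?c * measure lebesgue (\<Union>\<F>)"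
      using content_division[OF div] by (simp flip: sum_distrib_left)
    also have "\<dots> \<le> ?c * measure lebesgue T"
    proof (intro mult_left_mono[OF _ c] measure_mono_fmeasurable Tm)
      show "\<Union>\<F> \<subseteq> T" using KT T(2) F(1) by fastforce
      show "\<Union>\<F> \<in> sets lebesgue" using lmeasurable_division[OF div] by auto
    qed
    finally show ?thesis using cT by linarith
  qed
  have "measure lebesgue (f ` S) \<le> measure lebesgue (\<Union>K\<in>\<D>. cbox (a K) (b K))"
  proof (rule measure_mono_fmeasurable)
    show "f ` S \<subseteq> (\<Union>K\<in>\<D>. cbox (a K) (b K))" using SD ab by blast
    show "f ` S \<in> sets lebesgue"
      using compact_continuous_image[OF lipschitz_on_continuous_on[OF lip] S]
      by (simp add: lmeasurable_compact fmeasurableD)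
    show "(\<Union>K\<in>\<D>. cbox (a K) (b K)) \<in> lmeasurable"
      by (rule fmeasurable_UN_bound[OF D _ bound]) auto
  qed
  also have "\<dots> \<le> ?c * measure lebesgue S + e"
    by (rule measure_UN_bound[OF D _ bound]) auto
  finally show "measure lebesgue (f ` S) \<le> ?c * measure lebesgue S + e" .
qed

section \<open>Flows of Lipschitz vector fields\<close>

text \<open>Stated for arbitrary curves, so that uniqueness applies to restarted and time-shifted
  trajectories and not only to \<open>\<lambda>t. \<phi> s t x\<close>.\<close>

definition integral_curve ::
    "(real \<Rightarrow> 'a::euclidean_space \<Rightarrow> 'a) \<Rightarrow> 'a set \<Rightarrow> real \<Rightarrow> (real \<Rightarrow> 'a) \<Rightarrow> bool"
  where "integral_curve v X s x \<longleftrightarrow>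
    (\<forall>t\<ge>s. x t \<in> X \<and> (x has_vector_derivative v t (x t)) (at t within {s..}))"

text \<open>Gronwall in both directions: the squared distance \<open>w\<close> is differentiable
  even where the curves meet, and \<open>\<bar>w'\<bar> \<le> 2 * L * w\<close>. Hence
  \<open>w\<close> times \<open>exp (2 * L * (r - s))\<close> increases and \<open>w\<close> times
  \<open>exp (- 2 * L * (r - s))\<close> decreases. The lower bound on the later distance controls
  the inverse flow without solving backwards in time.\<close>

lemma integral_curve_dist:
  assumes lip: "\<And>t. L-lipschitz_on X (v t)"
    and x: "integral_curve v X s x" and y: "integral_curve v X s y" and "s \<le> t"
  shows integral_curve_dist_le: "dist (x t) (y t) \<le> exp (L * (t - s)) * dist (x s) (y s)"
    and integral_curve_dist_ge: "dist (x s) (y s) \<le> exp (L * (t - s)) * dist (x t) (y t)"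
proof -
  define w where "w r = (x r - y r) \<bullet> (x r - y r)" for r
  define w' where "w' r = 2 * ((x r - y r) \<bullet> (v r (x r) - v r (y r)))" for r
  have w_dist: "w r = (dist (x r) (y r))\<^sup>2" for r
    by (simp add: w_def dist_norm power2_norm_eq_inner)
  have w': "\<bar>w' r\<bar> \<le> 2 * L * w r" if "s \<le> r" for r
  proof -
    have "\<bar>(x r - y r) \<bullet> (v r (x r) - v r (y r))\<bar> \<le> dist (x r) (y r) * dist (v r (x r)) (v r (y r))"
      by (simp add: dist_norm Cauchy_Schwarz_ineq2)
    also have "\<dots> \<le> dist (x r) (y r) * (L * dist (x r) (y r))"
      using x y that by (intro mult_left_mono lipschitz_onD[OF lip]) (auto simp: integral_curve_def)
    finally show ?thesis by (simp add: w'_def w_dist power2_eq_square abs_mult algebra_simps)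
  qed
  have der_within: "(w has_vector_derivative w' r) (at r within {s..})" if "s \<le> r" for r
  proof -
    have "(x has_vector_derivative v r (x r)) (at r within {s..})"
      "(y has_vector_derivative v r (y r)) (at r within {s..})"
      using x y that by (auto simp: integral_curve_def)
    from has_vector_derivative_diff[OF this]
    have *: "((\<lambda>r. x r - y r) has_vector_derivative v r (x r) - v r (y r)) (at r within {s..})" .
    show ?thesis
      using bounded_bilinear.has_vector_derivative[OF bounded_bilinear_inner * *]
      by (simp add: w_def[abs_def] w'_def inner_commute)
  qed
  define h where "h c r = w r * exp (c * (r - s))" for c r
  have cont: "continuous_on {s..t} (h c)" for c
  proof -
    have "continuous_on {s..} w"
      unfolding continuous_on_eq_continuous_within
      using has_vector_derivative_continuous[OF der_within] by simp
    then have "continuous_on {s..t} w" by (rule continuous_on_subset) auto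
    then show ?thesis unfolding h_def by (intro continuous_intros)
  qed
  \<comment> \<open>After time \<open>s\<close> the one-sided derivative is two-sided. At
    \<open>s\<close> itself continuity is enough for the monotonicity rules on the open
    interval.\<close>
  have der: "(h c has_real_derivative (w' r + c * w r) * exp (c * (r - s))) (at r)" if "s < r" for c r
  proof -
    have "at r within {s..} = at r"
      using that by (intro at_within_interior) simp
    then have w: "(w has_real_derivative w' r) (at r)"
      using der_within[of r] that by (simp add: has_real_derivative_iff_has_vector_derivative)
    have "((\<lambda>r. exp (c * (r - s))) has_real_derivative c * exp (c * (r - s))) (at r)"
      by (auto intro!: derivative_eq_intros)
    from DERIV_mult[OF w this] show ?thesis
      unfolding h_def[abs_def] by (simp add: distrib_left mult_ac)
  qed
  have exp: "(exp (L * (t - s)))\<^sup>2 = exp (2 * L * (t - s))"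
    by (simp add: mult.assoc flip: exp_double)
  have "h (2 * L) s \<le> h (2 * L) t"
  proof (rule DERIV_nonneg_imp_increasing_open[OF \<open>s \<le> t\<close> _ cont])
    fix r assume "s < r"
    then have "0 \<le> (w' r + 2 * L * w r) * exp (2 * L * (r - s))"
      using w'[of r] by (intro mult_nonneg_nonneg) auto
    then show "\<exists>y. (h (2 * L) has_real_derivative y) (at r) \<and> 0 \<le> y"
      using der[OF \<open>s < r\<close>] by blast
  qed
  then have "(dist (x s) (y s))\<^sup>2 \<le> (exp (L * (t - s)) * dist (x t) (y t))\<^sup>2"
    by (simp add: h_def w_dist power_mult_distrib exp mult.commute)
  then show "dist (x s) (y s) \<le> exp (L * (t - s)) * dist (x t) (y t)"
    by (rule power2_le_imp_le) simp
  have "h (- (2 * L)) t \<le> h (- (2 * L)) s"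
  proof (rule DERIV_nonpos_imp_decreasing_open[OF \<open>s \<le> t\<close> _ cont])
    fix r assume "s < r"
    then have "(w' r + - (2 * L) * w r) * exp (- (2 * L) * (r - s)) \<le> 0"
      using w'[of r] by (intro mult_nonpos_nonneg) auto
    then show "\<exists>y. (h (- (2 * L)) has_real_derivative y) (at r) \<and> y \<le> 0"
      using der[OF \<open>s < r\<close>] by blast
  qed
  then have "w t / exp (2 * L * (t - s)) \<le> w s"
    by (simp add: h_def exp_minus divide_inverse)
  then have "w t \<le> exp (2 * L * (t - s)) * w s"
    by (simp add: pos_divide_le_eq mult.commute)
  then have "(dist (x t) (y t))\<^sup>2 \<le> (exp (L * (t - s)) * dist (x s) (y s))\<^sup>2"
    by (simp add: w_dist power_mult_distrib exp)
  then show "dist (x t) (y t) \<le> exp (L * (t - s)) * dist (x s) (y s)"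
    by (rule power2_le_imp_le) simp
qed

lemma integral_curve_unique:
  assumes "\<And>t. L-lipschitz_on X (v t)" "integral_curve v X s x" "integral_curve v X s y"
    and "x s = y s" "s \<le> t"
  shows "x t = y t"
  using integral_curve_dist_le[OF assms(1-3,5)] assms(4) by simp

section \<open>Lipschitz bounds, composition and periodicity of the flow map\<close>

locale lipschitz_flow =
  fixes X :: "'a::euclidean_space set"
    and v :: "real \<Rightarrow> 'a \<Rightarrow> 'a"
    and \<phi> :: "real \<Rightarrow> real \<Rightarrow> 'a \<Rightarrow> 'a"
    and L :: real
  assumes flow: "is_flow_map v X \<phi>"
    and lip: "\<And>t. L-lipschitz_on X (v t)"
begin

lemma flow_self: "x \<in> X \<Longrightarrow> \<phi> s s x = x"
  and flow_mem: "x \<in> X \<Longrightarrow> s \<le> t \<Longrightarrow> \<phi> s t x \<in> X"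
  and flow_inverse: "x \<in> X \<Longrightarrow> s \<le> t \<Longrightarrow> \<phi> t s (\<phi> s t x) = x"
  and flow_curve: "x \<in> X \<Longrightarrow> integral_curve v X s (\<lambda>t. \<phi> s t x)"
  using flow unfolding is_flow_map_def integral_curve_def by blast+

lemma flow_lipschitz:
  assumes "s \<le> t" shows "(exp (L * (t - s)))-lipschitz_on X (\<phi> s t)"
  using integral_curve_dist_le[OF lip flow_curve flow_curve assms]
  by (intro lipschitz_onI) (auto simp: flow_self)

text \<open>This is the lower Gronwall bound, read for the left inverse. The domain is the image of
  \<open>X\<close> because \<open>\<phi> t s\<close> is specified only there.\<close>

lemma flow_inverse_lipschitz:
  assumes "s \<le> t" shows "(exp (L * (t - s)))-lipschitz_on (\<phi> s t ` X) (\<phi> t s)"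
  using integral_curve_dist_ge[OF lip flow_curve flow_curve assms] assms
  by (intro lipschitz_onI) (auto simp: flow_self flow_inverse)

text \<open>As functions of \<open>t\<close>, both sides are integral curves from time
  \<open>s\<close> with the same initial point, so uniqueness identifies them.\<close>

lemma flow_flow:
  assumes "x \<in> X" "r \<le> s" "s \<le> t"
  shows "\<phi> s t (\<phi> r s x) = \<phi> r t x"
proof (rule integral_curve_unique[OF lip flow_curve _ _ assms(3)])
  show "integral_curve v X s (\<lambda>t. \<phi> r t x)"
    unfolding integral_curve_def
  proof (intro allI impI conjI)
    fix t assume "s \<le> t"
    then have "r \<le> t" using assms(2) by simp
    then show "\<phi> r t x \<in> X" by (rule flow_mem[OF assms(1)])
    have "((\<lambda>t. \<phi> r t x) has_vector_derivative v t (\<phi> r t x)) (at t within {r..})"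
      using flow_curve[OF assms(1)] \<open>r \<le> t\<close> by (simp add: integral_curve_def)
    then show "((\<lambda>t. \<phi> r t x) has_vector_derivative v t (\<phi> r t x)) (at t within {s..})"
      by (rule has_vector_derivative_within_subset) (use assms(2) in auto)
  qed
qed (use assms flow_mem flow_self in auto)

text \<open>Shifting a trajectory by a period of the field gives a trajectory of the same field;
  uniqueness does the rest.\<close>

lemma flow_periodic:
  assumes per: "\<And>t x. x \<in> X \<Longrightarrow> v (t + \<tau>) x = v t x" and x: "x \<in> X" and "s \<le> t"
  shows "\<phi> (s + \<tau>) (t + \<tau>) x = \<phi> s t x"
proof (rule integral_curve_unique[OF lip _ flow_curve[OF x] _ \<open>s \<le> t\<close>])
  show "integral_curve v X s (\<lambda>t. \<phi> (s + \<tau>) (t + \<tau>) x)"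
    unfolding integral_curve_def
  proof (intro allI impI conjI)
    fix t assume "s \<le> t"
    then show X: "\<phi> (s + \<tau>) (t + \<tau>) x \<in> X" using flow_mem[OF x] by simp
    have shift: "((\<lambda>t. t + \<tau>) has_vector_derivative 1) (at t within {s..})"
      by (auto intro!: derivative_eq_intros)
    have img: "(\<lambda>t. t + \<tau>) ` {s..} = {s + \<tau>..}"
      using image_add_atLeast[of \<tau> s] unfolding add.commute[of \<tau>] .
    have "((\<lambda>t. \<phi> (s + \<tau>) t x) has_vector_derivative v (t + \<tau>) (\<phi> (s + \<tau>) (t + \<tau>) x))
        (at (t + \<tau>) within (\<lambda>t. t + \<tau>) ` {s..})"
      using flow_curve[OF x, of "s + \<tau>"] \<open>s \<le> t\<close> unfolding img integral_curve_def by simp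
    from vector_diff_chain_within[OF shift this]
    show "((\<lambda>t. \<phi> (s + \<tau>) (t + \<tau>) x) has_vector_derivative v t (\<phi> (s + \<tau>) (t + \<tau>) x))
        (at t within {s..})"
      by (simp add: per[OF X] o_def)
  qed
qed (simp add: flow_self x)

section \<open>Survivor sets and escape rates\<close>

lemma compact_survivor_set:
  assumes X: "compact X" and A: "\<And>r. closed (A r)"
  shows "compact (survivor_set X \<phi> A s t)"
proof -
  have "closed (X \<inter> \<phi> s r -` A r)" if "r \<in> {s..t}" for r
    using that flow_lipschitz[of s r] compact_imp_closed[OF X] A
    by (intro continuous_closed_preimage lipschitz_on_continuous_on) auto
  \<comment> \<open>The outer \<open>X\<close> matters when \<open>t < s\<close>: the intersection
    over the empty interval is then the whole space, while the survivor set is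
    \<open>X\<close>.\<close>
  then have "compact (X \<inter> (\<Inter>r\<in>{s..t}. X \<inter> \<phi> s r -` A r))"
    by (intro compact_Int_closed X closed_INT) blast
  also have "X \<inter> (\<Inter>r\<in>{s..t}. X \<inter> \<phi> s r -` A r) = survivor_set X \<phi> A s t"
    by (auto simp: survivor_set_def)
  finally show ?thesis .
qed

lemma flow_survivor_set:
  assumes "s \<le> s'"
  shows "\<phi> s s' ` survivor_set X \<phi> A s t \<subseteq> survivor_set X \<phi> A s' t"
  using assms by (auto simp: survivor_set_def flow_mem flow_flow)

lemma measure_survivor_set_le:
  assumes X: "compact X" and A: "\<And>r. closed (A r)" and "s \<le> s'"
  shows "measure lebesgue (survivor_set X \<phi> A s t) \<le>
    (2 * exp (L * (s' - s)) * DIM('a)) ^ DIM('a) * measure lebesgue (survivor_set X \<phi> A s' t)"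
proof -
  let ?S = "survivor_set X \<phi> A s t" and ?S' = "survivor_set X \<phi> A s' t"
  let ?Y = "\<phi> s s' ` ?S"
  have SX: "?S \<subseteq> X" by (auto simp: survivor_set_def)
  have cY: "compact ?Y"
    using flow_lipschitz[OF \<open>s \<le> s'\<close>] SX
    by (intro compact_continuous_image compact_survivor_set X A)
      (blast intro: lipschitz_on_continuous_on continuous_on_subset)
  have "(exp (L * (s' - s)))-lipschitz_on ?Y (\<phi> s' s)"
    using flow_inverse_lipschitz[OF \<open>s \<le> s'\<close>] SX by (blast intro: lipschitz_on_subset)
  \<comment> \<open>So \<open>?S\<close> is a Lipschitz image of \<open>?Y\<close>, with a constant
    depending on \<open>s' - s\<close> but not on \<open>t\<close>.\<close>
  moreover have "\<phi> s' s ` ?Y = ?S"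
    using SX flow_inverse[OF _ \<open>s \<le> s'\<close>] by (force simp: image_image)
  ultimately have "measure lebesgue ?S \<le>
      (2 * exp (L * (s' - s)) * DIM('a)) ^ DIM('a) * measure lebesgue ?Y"
    using measure_lipschitz_image_le[OF _ cY] by metis
  also have "\<dots> \<le> (2 * exp (L * (s' - s)) * DIM('a)) ^ DIM('a) * measure lebesgue ?S'"
    using flow_survivor_set[OF \<open>s \<le> s'\<close>] cY compact_survivor_set[OF X A]
    by (intro mult_left_mono measure_mono_fmeasurable)
      (auto simp: lmeasurable_compact fmeasurableD)
  finally show ?thesis .
qed

end

text \<open>The factor \<open>C\<close> contributes \<open>ln C / (t - a)\<close>, which tends to 0,
  and \<open>(t - b) / (t - a)\<close> tends to 1, so neither affects the exponential rate.\<close>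

lemma Limsup_log_ereal_le:
  fixes p q :: "real \<Rightarrow> real"
  assumes C: "0 < C" and p: "\<And>t. 0 \<le> p t" and pq: "\<And>t. p t \<le> C * q t"
  shows "Limsup at_top (\<lambda>t. ereal (1 / (t - a)) * log_ereal (p t)) \<le>
    Limsup at_top (\<lambda>t. ereal (1 / (t - b)) * log_ereal (q t))"
\<comment> \<open>Testing against every \<open>c\<close> strictly above the right-hand side avoids
  arithmetic with an infinite limsup: \<open>c = \<infinity>\<close> is trivial and
  \<open>c = -\<infinity>\<close> impossible.\<close>
proof (rule dense_ge)
  fix c assume c: "Limsup at_top (\<lambda>t. ereal (1 / (t - b)) * log_ereal (q t)) < c"
  show "Limsup at_top (\<lambda>t. ereal (1 / (t - a)) * log_ereal (p t)) \<le> c"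
  proof (cases c)
    case (real c')
    \<comment> \<open>Eventually \<open>ln (q t) < c' * (t - b)\<close> when \<open>p t > 0\<close>;
      adding \<open>ln C\<close> and dividing by \<open>t - a\<close> yields \<open>?u\<close>. When
      \<open>p t = 0\<close> the left-hand side is \<open>-\<infinity>\<close>.\<close>
    let ?u = "\<lambda>t. (ln C + c' * (t - b)) / (t - a)"
    have "\<forall>\<^sub>F t in at_top. ereal (1 / (t - a)) * log_ereal (p t) \<le> ereal (?u t)"
      using Limsup_lessD[OF c] eventually_gt_at_top[of a] eventually_gt_at_top[of b]
    proof eventually_elim
      case (elim t)
      show ?case
      proof (cases "p t = 0")
        case False
        then have pt: "0 < p t" using p[of t] by simp
        then have "0 < C * q t" using pq[of t] by linarith
        then have qt: "0 < q t" using C by (simp add: zero_less_mult_iff)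
        have "ln (q t) / (t - b) < c'"
          using elim(1) qt real by (simp add: log_ereal_def)
        then have "ln (q t) < c' * (t - b)" using elim by (simp add: field_simps)
        moreover have "ln (p t) \<le> ln C + ln (q t)"
          using pt pq[of t] C qt by (metis ln_mult_pos ln_mono)
        ultimately have "ln (p t) / (t - a) \<le> ?u t"
          using elim by (intro divide_right_mono) auto
        then show ?thesis using False by (simp add: log_ereal_def)
      qed (use elim in \<open>simp add: log_ereal_def\<close>)
    qed
    then have "Limsup at_top (\<lambda>t. ereal (1 / (t - a)) * log_ereal (p t)) \<le>
        Limsup at_top (\<lambda>t. ereal (?u t))"
      by (rule Limsup_mono)
    also have "(?u \<longlongrightarrow> c') at_top"
    proof (rule Lim_transform_eventually)
      have "filterlim (\<lambda>t. t - a) at_infinity at_top"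
        using filterlim_tendsto_add_at_top[OF tendsto_const filterlim_ident, of "- a"]
        by (intro filterlim_at_top_imp_at_infinity) simp
      then show "((\<lambda>t. c' + (ln C + c' * (a - b)) / (t - a)) \<longlongrightarrow> c') at_top"
        using tendsto_add[OF tendsto_const tendsto_divide_0[OF tendsto_const]] by force
      show "\<forall>\<^sub>F t in at_top. c' + (ln C + c' * (a - b)) / (t - a) = ?u t"
        using eventually_gt_at_top[of a] by eventually_elim (simp add: field_simps)
    qed
    then have "Limsup at_top (\<lambda>t. ereal (?u t)) = c"
      unfolding real by (intro lim_imp_Limsup) auto
    finally show ?thesis .
  qed (use c in auto)
qed

section \<open>Monotonicity and periodicity of the escape rate\<close>

lemma (in lipschitz_flow) escape_rate_antimono:
  assumes "compact X" "\<And>r. closed (A r)" "s \<le> s'"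
  shows "escape_rate X \<phi> A s' \<le> escape_rate X \<phi> A s"
  unfolding escape_rate_def ereal_minus_le_minus
  using measure_survivor_set_le[OF assms]
  by (intro Limsup_log_ereal_le[of "(2 * exp (L * (s' - s)) * DIM('a)) ^ DIM('a)"]) auto

text \<open>Translating both times by \<open>\<tau>\<close> changes neither the survivor set nor the
  length \<open>t - s\<close>, and the filter \<open>at_top\<close> is invariant under
  translation.\<close>

lemma (in lipschitz_flow) escape_rate_periodic:
  assumes per: "\<And>t x. x \<in> X \<Longrightarrow> v (t + \<tau>) x = v t x" and A: "\<And>r. A (r + \<tau>) = A r"
  shows "escape_rate X \<phi> A (s + \<tau>) = escape_rate X \<phi> A s"
proof -
  let ?F = "\<lambda>s t. ereal (1 / (t - s)) * log_ereal (measure lebesgue (survivor_set X \<phi> A s t))"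
  have "survivor_set X \<phi> A (s + \<tau>) (t + \<tau>) = survivor_set X \<phi> A s t" for t
  proof -
    have eq: "{s + \<tau>..t + \<tau>} = (\<lambda>r. r + \<tau>) ` {s..t}"
      by (simp add: image_add_atLeastAtMost')
    have "(\<forall>r\<in>{s + \<tau>..t + \<tau>}. P r) \<longleftrightarrow> (\<forall>r\<in>{s..t}. P (r + \<tau>))" for P
      unfolding eq by blast
    then show ?thesis
      by (auto simp: survivor_set_def flow_periodic[OF per] A)
  qed
  then have shift: "(\<lambda>t. ?F (s + \<tau>) (t + \<tau>)) = ?F s" by simp
  have "filtermap (\<lambda>t. t + \<tau>) at_top = at_top"
    using filterlim_tendsto_add_at_top[OF tendsto_const filterlim_ident, of \<tau>]
      filterlim_tendsto_add_at_top[OF tendsto_const filterlim_ident, of "- \<tau>"]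
    by (intro filtermap_fun_inverse[where g = "\<lambda>t. t - \<tau>"]) (simp_all add: add.commute)
  then have "Limsup at_top (?F (s + \<tau>)) = Limsup at_top (?F s)"
    using Limsup_filtermap_eq[of "\<lambda>t. t + \<tau>" at_top "?F (s + \<tau>)"] shift
    by (simp add: inj_def)
  then show ?thesis by (simp add: escape_rate_def)
qed

theorem theorem10:
  fixes X :: "'a::euclidean_space set"
    and v :: "real \<Rightarrow> 'a \<Rightarrow> 'a"
    and \<phi> :: "real \<Rightarrow> real \<Rightarrow> 'a \<Rightarrow> 'a"
    and A :: "real \<Rightarrow> 'a set"
    and \<tau> L s\<^sub>1 s\<^sub>2 :: real
  assumes "\<tau> > 0"
    and "compact X"
    and "continuous_on (UNIV \<times> X) (\<lambda>(t, x). v t x)"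
    and "\<And>t x. x \<in> X \<Longrightarrow> v (t + \<tau>) x = v t x"
    and "\<And>t. L-lipschitz_on X (v t)"
    and "is_flow_map v X \<phi>"
    and "\<And>r. A r \<subseteq> X"
    and "\<And>r. A (r + \<tau>) = A r"
    and "nice_family A"
    and "s\<^sub>1 \<in> {0..<\<tau>}" and "s\<^sub>2 \<in> {0..<\<tau>}"
  shows "escape_rate X \<phi> A s\<^sub>1 = escape_rate X \<phi> A s\<^sub>2"
proof -
  interpret lipschitz_flow X v \<phi> L by unfold_locales (fact assms)+
  have closed: "closed (A r)" for r using assms(9) by (simp add: nice_family_def)
  \<comment> \<open>Since \<open>s'\<close> lies before \<open>s + \<tau>\<close> whatever the order
    of \<open>s\<close> and \<open>s'\<close>, monotonicity followed by periodicity gives this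
    inequality. It holds for both orderings of the pair, hence equality.\<close>
  have "escape_rate X \<phi> A s \<le> escape_rate X \<phi> A s'" if "s \<in> {0..<\<tau>}" "s' \<in> {0..<\<tau>}" for s s'
  proof -
    have "escape_rate X \<phi> A (s + \<tau>) \<le> escape_rate X \<phi> A s'"
      using that by (intro escape_rate_antimono assms closed) auto
    then show ?thesis using escape_rate_periodic[where \<tau> = \<tau> and A = A, OF assms(4,8)] by simp
  qed
  then show ?thesis using assms(10,11) by (intro antisym)
qed

end
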